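(* Let $K,L\subset\mathbb R^n$ be convex bodies satisfying $M(K,L)=|K\cap(-L)|$. Then, for every $\theta\in(0,1)$, $$K+_\theta L\ \subseteq\ \left\{x\in\mathbb R^n:\ |x|\,\left|\frac{d^+}{dt}\left|K\cap\left(t\frac{x}{|x|}-L\right)\right|_{t=0}\right|\ \le\ n(1-\theta^{\frac1n})M(K,L)\right\}.$$
   Context: A convex body in $\mathbb R^n$ is a compact convex set with non-empty interior; $|\cdot|$ denotes Lebesgue measure when applied to sets, the Euclidean norm when applied to vectors, and absolute value when applied to real numbers. $K+L$ is the Minkowski sum, $M(K,L)=\sup_{x\in K+L}|K\cap(x-L)|$, and for $\theta\in[0,1]$, $K+_\theta L=\{x\in K+L:\ |K\cap(x-L)|\ge\theta M(K,L)\}$. $\frac{d^+}{dt}$ denotes the right derivative, evaluated at $t=0$ in the claim. By convention $x=0$ belongs to the right-hand set (the left-hand side of the defining inequality is read as $0$ there). *)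

theory Defs
  imports "HOL-Analysis.Analysis" "HOL-Library.Set_Algebras"
begin

definition convex_body :: "(real ^ 'n) set \<Rightarrow> bool" where
  "convex_body K \<longleftrightarrow> compact K \<and> convex K \<and> interior K \<noteq> {}"

definition conv_vol :: "(real ^ 'n) set \<Rightarrow> (real ^ 'n) set \<Rightarrow> real ^ 'n \<Rightarrow> real" where
  "conv_vol K L x = measure lebesgue (K \<inter> (\<lambda>y. x - y) ` L)"

definition max_conv_vol :: "(real ^ 'n) set \<Rightarrow> (real ^ 'n) set \<Rightarrow> real" where
  "max_conv_vol K L = (SUP x \<in> K + L. conv_vol K L x)"

definition theta_sum :: "real \<Rightarrow> (real ^ 'n) set \<Rightarrow> (real ^ 'n) set \<Rightarrow> (real ^ 'n) set" where
  "theta_sum \<theta> K L = {x \<in> K + L. conv_vol K L x \<ge> \<theta> * max_conv_vol K L}"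

end

theory Submission
  imports Defs
begin

text \<open>
  By Brunn-Minkowski, the \<open>n\<close>-th root of \<open>x \<mapsto> |K \<inter> (x - L)|\<close> is concave on \<open>K + L\<close>. Along the ray
  through \<open>x\<close> this root is maximal at \<open>0\<close>, so its right derivative there exists, is non-positive, and
  is at least the slope of the chord over \<open>[0, |x|]\<close>; the chain rule for the \<open>n\<close>-th power gives the claim.

  Brunn-Minkowski is proved by the Hadwiger-Ohmann cutting argument, which never changes the dimension:
  a hyperplane cuts \<open>A\<close>, a parallel one cuts \<open>B\<close> in the same volume ratio, and the sums of corresponding
  pieces lie on opposite sides of a third parallel hyperplane, so that the inequality for the pieces
  implies it for \<open>A\<close> and \<open>B\<close>. This reduces finite unions of boxes to single boxes, where the inequality
  is the superadditivity of the geometric mean. Inner approximation extends it to bounded open sets,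
  outer approximation to compact ones.
\<close>

section \<open>Volume roots and Minkowski sums\<close>

definition vol_root :: "'a::euclidean_space set \<Rightarrow> real" where
  "vol_root A = root DIM('a) (measure lebesgue A)"

lemma vol_root_nonneg: "0 \<le> vol_root A"
  by (simp add: vol_root_def)

lemma vol_root_power: "vol_root A ^ DIM('a) = measure lebesgue A" for A :: "'a::euclidean_space set"
  by (simp add: vol_root_def)

lemma le_vol_root_iff:
  fixes A :: "'a::euclidean_space set"
  assumes "0 \<le> s"
  shows "s \<le> vol_root A \<longleftrightarrow> s ^ DIM('a) \<le> measure lebesgue A"
  using assms by (simp add: vol_root_nonneg power_mono_iff flip: vol_root_power)

lemma vol_root_mono:
  assumes "A \<subseteq> B" "A \<in> sets lebesgue" "B \<in> lmeasurable"
  shows "vol_root A \<le> vol_root B"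
  unfolding vol_root_def using assms by (simp add: measure_mono_fmeasurable)

lemma vol_root_scaleR: "vol_root ((\<lambda>x. c *\<^sub>R x) ` A) = \<bar>c\<bar> * vol_root A"
  using measure_lebesgue_affine[of c 0 A]
  by (simp add: vol_root_def real_root_mult real_root_power_cancel)

lemma root_prod_le_arith_mean:
  fixes x :: "'a \<Rightarrow> real"
  assumes "\<And>i. i \<in> S \<Longrightarrow> 0 \<le> x i"
  shows "root (card S) (\<Prod>i\<in>S. x i) \<le> (\<Sum>i\<in>S. x i) / card S"
proof (cases "finite S \<and> S \<noteq> {}")
  case True
  then have "root (card S) (\<Prod>i\<in>S. x i) = (\<Prod>i\<in>S. x i) powr (1 / card S)"
    using assms by (intro root_powr_inverse prod_nonneg) (auto simp: card_gt_0_iff)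
  also have "\<dots> \<le> (\<Sum>i\<in>S. x i) / card S"
    using arith_geom_mean[of S x] True assms by (simp add: sum_divide_distrib)
  finally show ?thesis .
qed auto

lemma root_prod_superadditive:
  fixes x y :: "'a \<Rightarrow> real"
  assumes x: "\<And>i. i \<in> S \<Longrightarrow> 0 \<le> x i" and y: "\<And>i. i \<in> S \<Longrightarrow> 0 \<le> y i"
  shows "root (card S) (\<Prod>i\<in>S. x i) + root (card S) (\<Prod>i\<in>S. y i) \<le> root (card S) (\<Prod>i\<in>S. x i + y i)"
proof (cases "finite S \<and> S \<noteq> {} \<and> (\<forall>i\<in>S. x i + y i \<noteq> 0)")
  case True
  define n where "n = card S"
  define p where "p = (\<Prod>i\<in>S. x i + y i)"
  have n: "0 < n" using True by (simp add: n_def card_gt_0_iff)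
  have pos: "0 < x i + y i" if "i \<in> S" for i
    using True x[OF that] y[OF that] that by (simp add: order_less_le)
  then have p: "0 < p" unfolding p_def by (intro prod_pos) auto
  have normalized: "root n (\<Prod>i\<in>S. z i) / root n p \<le> (\<Sum>i\<in>S. z i / (x i + y i)) / n"
    if "\<And>i. i \<in> S \<Longrightarrow> 0 \<le> z i" for z :: "'a \<Rightarrow> real"
    using root_prod_le_arith_mean[of S "\<lambda>i. z i / (x i + y i)"] that pos
    by (simp add: n_def p_def prod_dividef real_root_divide less_imp_le)
  have "(root n (\<Prod>i\<in>S. x i) + root n (\<Prod>i\<in>S. y i)) / root n p
      \<le> (\<Sum>i\<in>S. x i / (x i + y i)) / n + (\<Sum>i\<in>S. y i / (x i + y i)) / n"
    using normalized[of x] normalized[of y] x y by (simp add: add_divide_distrib)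
  also have "\<dots> = (\<Sum>i\<in>S. (x i + y i) / (x i + y i)) / n"
    unfolding add_divide_distrib sum.distrib ..
  also have "\<dots> = 1"
    using True n by (simp add: n_def)
  finally show ?thesis
    using n p by (simp add: divide_le_eq flip: n_def p_def)
next
  case False
  then consider (no_factor) "card S = 0" | (zero_factor) i where "finite S" "i \<in> S" "x i = 0" "y i = 0"
    using x y by (metis add_nonneg_eq_0_iff card.infinite card.empty)
  then show ?thesis
  proof cases
    case zero_factor
    then have "(\<Prod>i\<in>S. x i) = 0" "(\<Prod>i\<in>S. y i) = 0" "(\<Prod>i\<in>S. x i + y i) = 0"
      by (force intro: prod_zero)+
    then show ?thesis by simp
  qed simp
qed

lemma bounded_set_plus:
  fixes A B :: "'a::real_normed_vector set"
  assumes "bounded A" "bounded B"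
  shows "bounded (A + B)"
  using bounded_plus[OF assms] by (simp add: set_plus_image case_prod_unfold)

lemma open_set_plus:
  fixes A B :: "'a::real_normed_vector set"
  assumes "open A \<or> open B"
  shows "open (A + B)"
proof -
  have "A + B = (\<Union>x\<in>A. \<Union>y\<in>B. {x + y})" by (auto simp: set_plus_def)
  then show ?thesis using open_sums[OF assms] by simp
qed

lemma compact_set_plus:
  fixes A B :: "'a::real_normed_vector set"
  assumes "compact A" "compact B"
  shows "compact (A + B)"
proof -
  have "A + B = (\<Union>x\<in>A. \<Union>y\<in>B. {x + y})" by (auto simp: set_plus_def)
  then show ?thesis using compact_sums'[OF assms] by simp
qed

lemma measure_open_pos:
  fixes U :: "'a::euclidean_space set"
  assumes "open U" "bounded U" "U \<noteq> {}"
  shows "0 < measure lebesgue U"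
  using open_not_negligible[OF assms(1,3)] lmeasurable_open[OF assms(2,1)]
  by (simp add: negligible_iff_measure order_less_le)

section \<open>Cutting by parallel hyperplanes\<close>

lemma lmeasurable_Int_halfspace:
  assumes "U \<in> lmeasurable"
  shows "U \<inter> {x. x \<bullet> a < s} \<in> lmeasurable" "U \<inter> {x. s < x \<bullet> a} \<in> lmeasurable"
proof -
  have "{x. x \<bullet> a < s} \<in> sets lebesgue" "{x. s < x \<bullet> a} \<in> sets lebesgue"
    by (simp_all add: borel_open open_halfspace_component_lt open_halfspace_component_gt
        sets_completionI_sets)
  then show "U \<inter> {x. x \<bullet> a < s} \<in> lmeasurable" "U \<inter> {x. s < x \<bullet> a} \<in> lmeasurable"
    using assms by (auto intro: fmeasurable_Int_fmeasurable)
qed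

lemma measure_halfspaces_add:
  fixes U :: "'a::euclidean_space set"
  assumes U: "U \<in> lmeasurable" and a: "a \<noteq> 0"
  shows "measure lebesgue (U \<inter> {x. x \<bullet> a < s}) + measure lebesgue (U \<inter> {x. s < x \<bullet> a}) = measure lebesgue U"
proof -
  let ?L = "U \<inter> {x. x \<bullet> a < s}" and ?R = "U \<inter> {x. s < x \<bullet> a}"
  have "?R - ?L = ?R" by auto
  then have "measure lebesgue ?L + measure lebesgue ?R = measure lebesgue (?L \<union> ?R)"
    using measure_Un2[OF lmeasurable_Int_halfspace[OF U]] by metis
  also have "\<dots> = measure lebesgue U"
  proof (rule measure_negligible_symdiff[OF U])
    have "U - (?L \<union> ?R) \<union> ((?L \<union> ?R) - U) \<subseteq> {x. a \<bullet> x = s}" by (auto simp: inner_commute)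
    then show "negligible (U - (?L \<union> ?R) \<union> ((?L \<union> ?R) - U))"
      using negligible_hyperplane[of a s] a negligible_subset by blast
  qed
  finally show ?thesis .
qed

lemma continuous_on_measure_halfspace:
  fixes U :: "'a::euclidean_space set"
  assumes U: "U \<in> lmeasurable" and a: "a \<noteq> 0"
  shows "continuous_on T (\<lambda>s. measure lebesgue (U \<inter> {x. x \<bullet> a < s}))"
proof (rule continuous_on_sequentiallyI)
  fix u :: "nat \<Rightarrow> real" and s assume u: "u \<longlonglongrightarrow> s"
  have pointwise: "(\<lambda>n. indicator (U \<inter> {x. x \<bullet> a < u n}) x :: real) \<longlonglongrightarrow> indicator (U \<inter> {x. x \<bullet> a < s}) x"
    if "a \<bullet> x \<noteq> s" for x
  proof -
    have "\<forall>\<^sub>F n in sequentially. x \<bullet> a < u n \<longleftrightarrow> x \<bullet> a < s"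
    proof (cases "x \<bullet> a < s")
      case True
      from order_tendstoD(1)[OF u this] show ?thesis by eventually_elim (use True in simp)
    next
      case False
      with that have "s < x \<bullet> a" by (simp add: inner_commute)
      from order_tendstoD(2)[OF u this] show ?thesis by eventually_elim (use False in simp)
    qed
    then show ?thesis
      by (intro tendsto_eventually) (auto elim: eventually_mono simp: indicator_def)
  qed
  have "(\<lambda>n. LINT x|lebesgue. indicator (U \<inter> {x. x \<bullet> a < u n}) x :: real)
      \<longlonglongrightarrow> (LINT x|lebesgue. indicator (U \<inter> {x. x \<bullet> a < s}) x)"
  proof (rule integral_dominated_convergence)
    show "integrable lebesgue (indicator U :: 'a \<Rightarrow> real)"
      using U by (auto simp: fmeasurable_def intro!: integrable_real_indicator)
    have "AE x in lebesgue. x \<notin> {x. a \<bullet> x = s}"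
      using negligible_hyperplane[of a s] a by (intro AE_not_in) (simp add: negligible_iff_null_sets)
    then show "AE x in lebesgue. (\<lambda>n. indicator (U \<inter> {x. x \<bullet> a < u n}) x :: real)
        \<longlonglongrightarrow> indicator (U \<inter> {x. x \<bullet> a < s}) x"
      by eventually_elim (simp add: pointwise)
    show "AE x in lebesgue. norm (indicator (U \<inter> {x. x \<bullet> a < u n}) x :: real) \<le> indicator U x" for n
      by (auto simp: indicator_def)
  qed (use U in \<open>auto intro!: borel_measurable_indicator fmeasurableD lmeasurable_Int_halfspace\<close>)
  then show "(\<lambda>n. measure lebesgue (U \<inter> {x. x \<bullet> a < u n})) \<longlonglongrightarrow> measure lebesgue (U \<inter> {x. x \<bullet> a < s})"
    using U by (simp add: fmeasurableD lmeasurable_Int_halfspace)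
qed

lemma exists_halfspace_measure:
  fixes U :: "'a::euclidean_space set"
  assumes U: "U \<in> lmeasurable" "bounded U" and a: "a \<noteq> 0" and ratio: "0 \<le> m" "m \<le> 1"
  obtains s where "measure lebesgue (U \<inter> {x. x \<bullet> a < s}) = m * measure lebesgue U"
proof -
  obtain r where r: "0 < r" "\<And>x. x \<in> U \<Longrightarrow> norm x < r"
    using U(2) by (auto simp: bounded_pos_less)
  have "\<bar>x \<bullet> a\<bar> < r * norm a" if "x \<in> U" for x
    using Cauchy_Schwarz_ineq2[of x a] r(2)[OF that] a
    by (meson mult_strict_right_mono order_le_less_trans zero_less_norm_iff)
  then have "U \<inter> {x. x \<bullet> a < - (r * norm a)} = {}" "U \<inter> {x. x \<bullet> a < r * norm a} = U"
    by fastforce+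
  then have "\<exists>s\<ge>- (r * norm a). s \<le> r * norm a \<and>
      measure lebesgue (U \<inter> {x. x \<bullet> a < s}) = m * measure lebesgue U"
    using ratio r(1) continuous_on_measure_halfspace[OF U(1) a]
    by (intro IVT') (auto simp: mult_left_le_one_le)
  then show thesis using that by blast
qed

definition Brunn_Minkowski_pair :: "'a::euclidean_space set \<Rightarrow> 'a set \<Rightarrow> bool" where
  "Brunn_Minkowski_pair A B \<longleftrightarrow> (A \<noteq> {} \<and> B \<noteq> {} \<longrightarrow> vol_root A + vol_root B \<le> vol_root (A + B))"

lemma Brunn_Minkowski_pair_commute: "Brunn_Minkowski_pair A B \<longleftrightarrow> Brunn_Minkowski_pair B A"
  by (auto simp: Brunn_Minkowski_pair_def add.commute)

lemma Brunn_Minkowski_pair_proportional: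
  fixes A B A' B' :: "'a::euclidean_space set"
  assumes "Brunn_Minkowski_pair A' B'" and "0 \<le> m"
    and A: "0 < measure lebesgue A" "measure lebesgue A' = m * measure lebesgue A"
    and B: "0 < measure lebesgue B" "measure lebesgue B' = m * measure lebesgue B"
  shows "m * (vol_root A + vol_root B) ^ DIM('a) \<le> measure lebesgue (A' + B')"
proof (cases "m = 0")
  case False
  then have "0 < measure lebesgue A'" "0 < measure lebesgue B'"
    using assms by (simp_all add: order_less_le)
  then have "A' \<noteq> {}" "B' \<noteq> {}" by auto
  then have "vol_root A' + vol_root B' \<le> vol_root (A' + B')"
    using assms(1) by (simp add: Brunn_Minkowski_pair_def)
  then have "(vol_root A' + vol_root B') ^ DIM('a) \<le> measure lebesgue (A' + B')"
    by (simp add: le_vol_root_iff vol_root_nonneg)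
  moreover have "vol_root A' + vol_root B' = root DIM('a) m * (vol_root A + vol_root B)"
    using A(2) B(2) by (simp add: vol_root_def real_root_mult distrib_left)
  ultimately show ?thesis
    using assms(2) by (simp add: power_mult_distrib)
qed simp

lemma exists_proportional_halfspaces:
  fixes A B :: "'a::euclidean_space set"
  assumes A: "A \<in> lmeasurable" "0 < measure lebesgue A" and B: "B \<in> lmeasurable" "bounded B"
    and a: "a \<noteq> 0"
  obtains m r where "0 \<le> m" "m \<le> 1"
    and "measure lebesgue (A \<inter> {x. x \<bullet> a < s}) = m * measure lebesgue A"
    and "measure lebesgue (A \<inter> {x. s < x \<bullet> a}) = (1 - m) * measure lebesgue A"
    and "measure lebesgue (B \<inter> {x. x \<bullet> a < r}) = m * measure lebesgue B"
    and "measure lebesgue (B \<inter> {x. r < x \<bullet> a}) = (1 - m) * measure lebesgue B"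
proof -
  define m where "m = measure lebesgue (A \<inter> {x. x \<bullet> a < s}) / measure lebesgue A"
  have lower_A: "measure lebesgue (A \<inter> {x. x \<bullet> a < s}) = m * measure lebesgue A"
    using A(2) by (simp add: m_def)
  then have upper_A: "measure lebesgue (A \<inter> {x. s < x \<bullet> a}) = (1 - m) * measure lebesgue A"
    using measure_halfspaces_add[OF A(1) a, of s] by (simp add: algebra_simps)
  have "0 \<le> m" by (simp add: m_def)
  moreover have "m \<le> 1"
  proof -
    have "0 \<le> (1 - m) * measure lebesgue A" by (metis upper_A measure_nonneg)
    then show ?thesis using A(2) by (simp add: zero_le_mult_iff del: measure_completion)
  qed
  moreover obtain r where lower_B: "measure lebesgue (B \<inter> {x. x \<bullet> a < r}) = m * measure lebesgue B"
    using exists_halfspace_measure[OF B a] calculation by blast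
  moreover have "measure lebesgue (B \<inter> {x. r < x \<bullet> a}) = (1 - m) * measure lebesgue B"
    using measure_halfspaces_add[OF B(1) a, of r] lower_B by (simp add: algebra_simps)
  ultimately show thesis using that lower_A upper_A by blast
qed

lemma measure_halfspace_sums_le:
  fixes A B :: "'a::euclidean_space set"
  assumes A: "open A" "bounded A" and B: "open B" "bounded B"
  shows "measure lebesgue ((A \<inter> {x. x \<bullet> a < s}) + (B \<inter> {x. x \<bullet> a < r}))
       + measure lebesgue ((A \<inter> {x. s < x \<bullet> a}) + (B \<inter> {x. r < x \<bullet> a}))
       \<le> measure lebesgue (A + B)" (is "measure lebesgue ?P + measure lebesgue ?Q \<le> _")
proof -
  have lmeas: "?P \<in> lmeasurable" "?Q \<in> lmeasurable" "A + B \<in> lmeasurable"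
    using A B
    by (auto intro!: lmeasurable_open bounded_set_plus open_set_plus bounded_Int open_Int
        open_halfspace_component_lt open_halfspace_component_gt)
  have "?P \<subseteq> {x. x \<bullet> a < s + r}" "?Q \<subseteq> {x. s + r < x \<bullet> a}"
    by (auto simp: set_plus_def inner_add_left intro: add_strict_mono)
  then have "?Q - ?P = ?Q" by fastforce
  then have "measure lebesgue ?P + measure lebesgue ?Q = measure lebesgue (?P \<union> ?Q)"
    using measure_Un2[OF lmeas(1,2)] by simp
  also have "\<dots> \<le> measure lebesgue (A + B)"
    using lmeas by (intro measure_mono_fmeasurable) (auto simp: set_plus_def)
  finally show ?thesis .
qed

lemma Brunn_Minkowski_pair_cut:
  fixes A B :: "'a::euclidean_space set"
  assumes A: "open A" "bounded A" and B: "open B" "bounded B" and a: "a \<noteq> 0"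
    and lower: "\<And>r. Brunn_Minkowski_pair (A \<inter> {x. x \<bullet> a < s}) (B \<inter> {x. x \<bullet> a < r})"
    and upper: "\<And>r. Brunn_Minkowski_pair (A \<inter> {x. s < x \<bullet> a}) (B \<inter> {x. r < x \<bullet> a})"
  shows "Brunn_Minkowski_pair A B"
  unfolding Brunn_Minkowski_pair_def
proof (intro impI, elim conjE)
  assume "A \<noteq> {}" "B \<noteq> {}"
  then have pos: "0 < measure lebesgue A" "0 < measure lebesgue B"
    using measure_open_pos A B by blast+
  obtain m r where ratio: "0 \<le> m" "m \<le> 1"
    and cut: "measure lebesgue (A \<inter> {x. x \<bullet> a < s}) = m * measure lebesgue A"
      "measure lebesgue (A \<inter> {x. s < x \<bullet> a}) = (1 - m) * measure lebesgue A"
      "measure lebesgue (B \<inter> {x. x \<bullet> a < r}) = m * measure lebesgue B"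
      "measure lebesgue (B \<inter> {x. r < x \<bullet> a}) = (1 - m) * measure lebesgue B"
    using exists_proportional_halfspaces[of A B a s] lmeasurable_open A B a pos(1) by metis
  let ?v = "(vol_root A + vol_root B) ^ DIM('a)"
  have "?v = m * ?v + (1 - m) * ?v" by (simp add: algebra_simps)
  also have "\<dots> \<le> measure lebesgue ((A \<inter> {x. x \<bullet> a < s}) + (B \<inter> {x. x \<bullet> a < r}))
      + measure lebesgue ((A \<inter> {x. s < x \<bullet> a}) + (B \<inter> {x. r < x \<bullet> a}))"
    using ratio by (intro add_mono Brunn_Minkowski_pair_proportional lower upper pos cut) auto
  also have "\<dots> \<le> measure lebesgue (A + B)"
    using A B by (rule measure_halfspace_sums_le)
  finally show "vol_root A + vol_root B \<le> vol_root (A + B)"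
    by (simp add: le_vol_root_iff vol_root_nonneg)
qed

section \<open>Dissections into boxes\<close>

lemma box_subset_box_plus_box:
  fixes a b c d :: "'a::euclidean_space"
  assumes "box a b \<noteq> {}" "box c d \<noteq> {}"
  shows "box (a + c) (b + d) \<subseteq> box a b + box c d"
proof
  fix z assume z: "z \<in> box (a + c) (b + d)"
  have "box a b \<inter> box (z - d) (z - c) \<noteq> {}"
    using assms z by (fastforce simp: disjoint_interval box_ne_empty mem_box inner_simps)
  then obtain x where x: "x \<in> box a b" "x \<in> box (z - d) (z - c)" by blast
  then have "z - x \<in> box c d" by (fastforce simp: mem_box inner_simps)
  with x(1) have "x + (z - x) \<in> box a b + box c d" by (rule set_plus_intro)
  then show "z \<in> box a b + box c d" by simp
qed

lemma Brunn_Minkowski_pair_box: "Brunn_Minkowski_pair (box a b) (box c d)"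
  unfolding Brunn_Minkowski_pair_def
proof (intro impI, elim conjE)
  assume ne: "box a b \<noteq> {}" "box c d \<noteq> {}"
  then have less: "a \<bullet> i < b \<bullet> i" "c \<bullet> i < d \<bullet> i" if "i \<in> Basis" for i
    using that by (auto simp: box_ne_empty)
  have vol_root_box: "vol_root (box p q) = root DIM('a) (\<Prod>i\<in>Basis. (q - p) \<bullet> i)"
    if "\<And>i. i \<in> Basis \<Longrightarrow> p \<bullet> i < q \<bullet> i" for p q :: 'a
    using that by (simp add: vol_root_def measure_lborel_box_eq less_imp_le)
  have "vol_root (box a b) + vol_root (box c d)
      = root DIM('a) (\<Prod>i\<in>Basis. (b - a) \<bullet> i) + root DIM('a) (\<Prod>i\<in>Basis. (d - c) \<bullet> i)"
    using less by (simp add: vol_root_box)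
  also have "\<dots> \<le> root DIM('a) (\<Prod>i\<in>Basis. (b - a) \<bullet> i + (d - c) \<bullet> i)"
    using less by (intro root_prod_superadditive) (auto simp: inner_diff_left less_imp_le)
  also have "\<dots> = vol_root (box (a + c) (b + d))"
    using less by (subst vol_root_box) (auto simp: inner_simps algebra_simps add_strict_mono)
  also have "\<dots> \<le> vol_root (box a b + box c d)"
    by (intro vol_root_mono box_subset_box_plus_box ne lmeasurable_open bounded_set_plus open_set_plus) auto
  finally show "vol_root (box a b) + vol_root (box c d) \<le> vol_root (box a b + box c d)" .
qed

lemma box_split:
  fixes a b :: "'a::euclidean_space"
  assumes "k \<in> Basis"
  shows "box a b \<inter> {x. x \<bullet> k < s} = box a (\<Sum>i\<in>Basis. (if i = k then min (b \<bullet> k) s else b \<bullet> i) *\<^sub>R i)"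
    and "box a b \<inter> {x. s < x \<bullet> k} = box (\<Sum>i\<in>Basis. (if i = k then max (a \<bullet> k) s else a \<bullet> i) *\<^sub>R i) b"
  using assms by (intro set_eqI; auto simp: mem_box)+

text \<open>A cut ignores the part of \<open>U\<close> on the hyperplane, which is a null set.\<close>

inductive box_dissectible :: "'a::euclidean_space set \<Rightarrow> bool" where
  box: "box_dissectible (box a b)"
| cut: "\<lbrakk>open U; bounded U; k \<in> Basis; box_dissectible (U \<inter> {x. x \<bullet> k < s});
    box_dissectible (U \<inter> {x. s < x \<bullet> k})\<rbrakk> \<Longrightarrow> box_dissectible U"

lemma box_dissectible_imp_open: "box_dissectible U \<Longrightarrow> open U"
  by (induction rule: box_dissectible.induct) auto

lemma box_dissectible_imp_bounded: "box_dissectible U \<Longrightarrow> bounded U"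
  by (induction rule: box_dissectible.induct) auto

lemma box_dissectible_Int:
  assumes "box_dissectible U" "open H" "\<And>a b. \<exists>c d. box a b \<inter> H = box c d"
  shows "box_dissectible (U \<inter> H)"
  using assms(1)
proof induction
  case (box a b)
  then show ?case using assms(3) by (metis box_dissectible.box)
next
  case (cut U k s)
  then show ?case
    using assms(2) by (intro box_dissectible.cut[of "U \<inter> H" k s]) (auto simp: Int_ac)
qed

lemma box_dissectible_Int_halfspace:
  assumes "box_dissectible U" "k \<in> Basis"
  shows "box_dissectible (U \<inter> {x. x \<bullet> k < s})" "box_dissectible (U \<inter> {x. s < x \<bullet> k})"
  using assms box_split[OF assms(2)]
  by (blast intro: box_dissectible_Int open_halfspace_component_lt open_halfspace_component_gt)+

lemma Brunn_Minkowski_pair_dissectible_box: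
  assumes "box_dissectible U"
  shows "Brunn_Minkowski_pair U (box a b)"
  using assms
proof (induction arbitrary: a b)
  case (cut U k s)
  show ?case
  proof (rule Brunn_Minkowski_pair_cut)
    show "Brunn_Minkowski_pair (U \<inter> {x. x \<bullet> k < s}) (box a b \<inter> {x. x \<bullet> k < r})" for r
      unfolding box_split[OF cut.hyps(3)] by (rule cut.IH)
    show "Brunn_Minkowski_pair (U \<inter> {x. s < x \<bullet> k}) (box a b \<inter> {x. r < x \<bullet> k})" for r
      unfolding box_split[OF cut.hyps(3)] by (rule cut.IH)
  qed (use cut.hyps in auto)
qed (rule Brunn_Minkowski_pair_box)

lemma Brunn_Minkowski_pair_dissectible:
  assumes "box_dissectible U" "box_dissectible V"
  shows "Brunn_Minkowski_pair U V"
  using assms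
proof (induction arbitrary: V)
  case (box a b)
  then show ?case using Brunn_Minkowski_pair_dissectible_box Brunn_Minkowski_pair_commute by blast
next
  case (cut U k s)
  then show ?case
    by (intro Brunn_Minkowski_pair_cut[of U V k s])
       (auto intro: box_dissectible_Int_halfspace box_dissectible_imp_open box_dissectible_imp_bounded)
qed

lemma box_dissectible_by_slabs:
  fixes U :: "'a::euclidean_space set"
  assumes "finite I" "I \<subseteq> Basis" "open U" "bounded U"
    and "\<And>k. k \<in> I \<Longrightarrow> box_dissectible (U \<inter> {x. x \<bullet> k < a \<bullet> k})"
    and "\<And>k. k \<in> I \<Longrightarrow> box_dissectible (U \<inter> {x. b \<bullet> k < x \<bullet> k})"
    and "box_dissectible (U \<inter> {x. \<forall>k\<in>I. a \<bullet> k < x \<bullet> k \<and> x \<bullet> k < b \<bullet> k})"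
  shows "box_dissectible U"
  using assms
proof (induction I arbitrary: U rule: finite_induct)
  case empty
  then show ?case by simp
next
  case (insert k I)
  let ?R = "{x. a \<bullet> k < x \<bullet> k}" and ?L = "{x. x \<bullet> k < b \<bullet> k}"
  have k: "k \<in> Basis" using insert.prems by simp
  have slab: "box_dissectible (X \<inter> ?R \<inter> ?L)" if "box_dissectible X" for X
    using that k by (simp add: box_dissectible_Int_halfspace)
  have core: "box_dissectible (U \<inter> ?R \<inter> ?L)"
  proof (rule insert.IH)
    have commute: "U \<inter> ?R \<inter> ?L \<inter> H = U \<inter> H \<inter> ?R \<inter> ?L" for H by auto
    show "box_dissectible (U \<inter> ?R \<inter> ?L \<inter> {x. x \<bullet> j < a \<bullet> j})" if "j \<in> I" for j
      unfolding commute using insert.prems that by (intro slab) auto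
    show "box_dissectible (U \<inter> ?R \<inter> ?L \<inter> {x. b \<bullet> j < x \<bullet> j})" if "j \<in> I" for j
      unfolding commute using insert.prems that by (intro slab) auto
    have "U \<inter> ?R \<inter> ?L \<inter> {x. \<forall>j\<in>I. a \<bullet> j < x \<bullet> j \<and> x \<bullet> j < b \<bullet> j}
        = U \<inter> {x. \<forall>j\<in>insert k I. a \<bullet> j < x \<bullet> j \<and> x \<bullet> j < b \<bullet> j}"
      by auto
    then show "box_dissectible (U \<inter> ?R \<inter> ?L \<inter> {x. \<forall>j\<in>I. a \<bullet> j < x \<bullet> j \<and> x \<bullet> j < b \<bullet> j})"
      using insert.prems by simp
  qed (use insert.prems in \<open>auto intro: open_halfspace_component_lt open_halfspace_component_gt\<close>)
  have "box_dissectible (U \<inter> ?R \<inter> {x. b \<bullet> k < x \<bullet> k})"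
    using box_dissectible_Int_halfspace(2)[OF _ k, of "U \<inter> {x. b \<bullet> k < x \<bullet> k}" "a \<bullet> k"] insert.prems
    by (simp add: Int_ac)
  then have "box_dissectible (U \<inter> ?R)"
    using core insert.prems k
    by (intro box_dissectible.cut[of "U \<inter> ?R" k "b \<bullet> k"]) (auto intro: open_halfspace_component_gt)
  then show ?case
    using insert.prems k by (intro box_dissectible.cut[of U k "a \<bullet> k"]) auto
qed

lemma box_dissectible_Un_box:
  assumes U: "box_dissectible U"
  shows "box_dissectible (box a b \<union> U)"
proof (rule box_dissectible_by_slabs[of Basis])
  show "box_dissectible ((box a b \<union> U) \<inter> {x. x \<bullet> k < a \<bullet> k})" if "k \<in> Basis" for k
  proof -
    have "(box a b \<union> U) \<inter> {x. x \<bullet> k < a \<bullet> k} = U \<inter> {x. x \<bullet> k < a \<bullet> k}"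
      using that by (fastforce simp: mem_box)
    then show ?thesis using U that by (simp add: box_dissectible_Int_halfspace)
  qed
  show "box_dissectible ((box a b \<union> U) \<inter> {x. b \<bullet> k < x \<bullet> k})" if "k \<in> Basis" for k
  proof -
    have "(box a b \<union> U) \<inter> {x. b \<bullet> k < x \<bullet> k} = U \<inter> {x. b \<bullet> k < x \<bullet> k}"
      using that by (fastforce simp: mem_box)
    then show ?thesis using U that by (simp add: box_dissectible_Int_halfspace)
  qed
  have "(box a b \<union> U) \<inter> {x. \<forall>k\<in>Basis. a \<bullet> k < x \<bullet> k \<and> x \<bullet> k < b \<bullet> k} = box a b"
    by (auto simp: mem_box)
  then show "box_dissectible ((box a b \<union> U) \<inter> {x. \<forall>k\<in>Basis. a \<bullet> k < x \<bullet> k \<and> x \<bullet> k < b \<bullet> k})"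
    by (simp add: box_dissectible.box)
qed (use box_dissectible_imp_open[OF U] box_dissectible_imp_bounded[OF U] in auto)

lemma box_dissectible_Union:
  assumes "finite \<D>" "\<And>X. X \<in> \<D> \<Longrightarrow> \<exists>a b. X = box a b"
  shows "box_dissectible (\<Union>\<D>)"
  using assms
proof (induction rule: finite_induct)
  case empty
  have "box_dissectible (box 0 0)" by (rule box_dissectible.box)
  then show ?case by simp
next
  case (insert X \<D>)
  then show ?case using box_dissectible_Un_box by fastforce
qed

section \<open>The Brunn-Minkowski inequality\<close>

lemma box_dissectible_approximation:
  fixes U :: "'a::euclidean_space set"
  assumes U: "open U" "bounded U"
  obtains F where "\<And>n. box_dissectible (F n)" "\<And>n. F n \<subseteq> U"
    "(\<lambda>n. measure lebesgue (F n)) \<longlonglongrightarrow> measure lebesgue U"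
proof (cases "U = {}")
  case True
  have "box_dissectible ({} :: 'a set)" using box_dissectible_Union[of "{}"] by simp
  then show thesis using that[of "\<lambda>_. {}"] True by simp
next
  case False
  obtain \<D> where \<D>: "countable \<D>" "\<And>X. X \<in> \<D> \<Longrightarrow> \<exists>a b. X = box a b" "\<Union>\<D> = U"
    using open_countable_Union_open_box[OF U(1)] by metis
  define F where "F n = \<Union>(from_nat_into \<D> ` {..n})" for n
  have "\<D> \<noteq> {}" using False \<D>(3) by blast
  then have dissectible: "box_dissectible (F n)" for n
    unfolding F_def using \<D>(2) by (intro box_dissectible_Union) (auto intro: from_nat_into)
  have "(\<Union>n. F n) = \<Union>(range (from_nat_into \<D>))" by (auto simp: F_def)
  then have F: "(\<Union>n. F n) = U"
    using range_from_nat_into[OF \<open>\<D> \<noteq> {}\<close> \<D>(1)] \<D>(3) by simp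
  have "(\<lambda>n. measure lebesgue (F n)) \<longlonglongrightarrow> measure lebesgue (\<Union>n. F n)"
  proof (rule Lim_measure_incseq)
    show "range F \<subseteq> sets lebesgue"
      using box_dissectible_imp_open[OF dissectible] by (blast intro: lborelD borel_open)
    show "incseq F" unfolding F_def by (intro monoI Union_mono image_mono) auto
    show "emeasure lebesgue (\<Union>n. F n) \<noteq> \<infinity>"
      unfolding F using fmeasurableD2[OF lmeasurable_open[OF U(2,1)]] by (simp del: emeasure_completion)
  qed
  then show thesis using that dissectible F by (metis UN_upper UNIV_I)
qed

lemma Brunn_Minkowski_pair_open:
  fixes A B :: "'a::euclidean_space set"
  assumes A: "open A" "bounded A" and B: "open B" "bounded B"
  shows "Brunn_Minkowski_pair A B"
  unfolding Brunn_Minkowski_pair_def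
proof (intro impI, elim conjE)
  assume "A \<noteq> {}" "B \<noteq> {}"
  then have pos: "0 < measure lebesgue A" "0 < measure lebesgue B"
    using measure_open_pos A B by blast+
  obtain F where F: "\<And>n. box_dissectible (F n)" "\<And>n. F n \<subseteq> A"
      "(\<lambda>n. measure lebesgue (F n)) \<longlonglongrightarrow> measure lebesgue A"
    using box_dissectible_approximation[OF A] by blast
  obtain G where G: "\<And>n. box_dissectible (G n)" "\<And>n. G n \<subseteq> B"
      "(\<lambda>n. measure lebesgue (G n)) \<longlonglongrightarrow> measure lebesgue B"
    using box_dissectible_approximation[OF B] by blast
  have "(\<lambda>n. vol_root (F n) + vol_root (G n)) \<longlonglongrightarrow> vol_root A + vol_root B"
    unfolding vol_root_def by (intro tendsto_intros F(3) G(3))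
  moreover have "\<forall>\<^sub>F n in sequentially. vol_root (F n) + vol_root (G n) \<le> vol_root (A + B)"
    using order_tendstoD(1)[OF F(3) pos(1)] order_tendstoD(1)[OF G(3) pos(2)]
  proof eventually_elim
    case (elim n)
    then have "F n \<noteq> {}" "G n \<noteq> {}" by auto
    then have "vol_root (F n) + vol_root (G n) \<le> vol_root (F n + G n)"
      using Brunn_Minkowski_pair_dissectible[OF F(1) G(1)] by (simp add: Brunn_Minkowski_pair_def)
    also have "\<dots> \<le> vol_root (A + B)"
    proof (rule vol_root_mono)
      show "F n + G n \<subseteq> A + B" by (intro set_plus_mono2 F G)
      have "open (F n + G n)" by (simp add: open_set_plus box_dissectible_imp_open F(1))
      then show "F n + G n \<in> sets lebesgue" by (simp add: borel_open sets_completionI_sets)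
      show "A + B \<in> lmeasurable" using A B by (intro lmeasurable_open bounded_set_plus open_set_plus) auto
    qed
    finally show ?case .
  qed
  ultimately show "vol_root A + vol_root B \<le> vol_root (A + B)"
    by (intro tendsto_upperbound) auto
qed

lemma lmeasurable_outer_open:
  fixes S :: "'a::euclidean_space set"
  assumes S: "S \<in> lmeasurable" and e: "0 < e"
  obtains U where "open U" "S \<subseteq> U" "U \<in> lmeasurable" "measure lebesgue U < measure lebesgue S + e"
proof -
  obtain U where U: "open U" "S \<subseteq> U" "U - S \<in> lmeasurable" "emeasure lebesgue (U - S) < ennreal e"
    using sets_lebesgue_outer_open[OF fmeasurableD[OF S] e] .
  have "S \<union> (U - S) = U" using U(2) by blast
  then have "U \<in> lmeasurable" "measure lebesgue U = measure lebesgue S + measure lebesgue (U - S)"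
    using fmeasurable.Un[OF S U(3)] measure_Un2[OF S U(3)] by simp_all
  moreover have "measure lebesgue (U - S) < e"
    using U(4) e by (simp add: emeasure_eq_measure2[OF U(3)] ennreal_less_iff
        del: measure_completion emeasure_completion)
  ultimately show thesis using that U by simp
qed

lemma exists_open_thickening:
  fixes A B U :: "'a::real_normed_vector set"
  assumes A: "compact A" and B: "compact B" and U: "open U" "A + B \<subseteq> U"
  obtains N where "open N" "bounded N" "0 \<in> N" "(A + N) + (B + N) \<subseteq> U"
proof -
  obtain d where d: "0 < d" "(\<Union>x\<in>A + B. ball x d) \<subseteq> U"
    using compact_subset_open_imp_ball_epsilon_subset[OF compact_set_plus[OF A B] U] .
  let ?N = "ball (0::'a) (d / 2)"
  have "(A + ?N) + (B + ?N) \<subseteq> U"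
  proof
    fix z assume "z \<in> (A + ?N) + (B + ?N)"
    then obtain a b u v where z: "a \<in> A" "b \<in> B" "u \<in> ?N" "v \<in> ?N" "z = (a + u) + (b + v)"
      by (auto elim!: set_plus_elim)
    have "norm (u + v) < d"
      using z(3,4) norm_triangle_ineq[of u v] by simp
    then have "z \<in> ball (a + b) d"
      using norm_minus_cancel[of "u + v"] by (simp add: z(5) dist_norm algebra_simps)
    then show "z \<in> U" using d(2) z(1,2) by blast
  qed
  then show thesis using that[of ?N] d(1) by simp
qed

theorem Brunn_Minkowski_compact:
  fixes A B :: "'a::euclidean_space set"
  assumes A: "compact A" "A \<noteq> {}" and B: "compact B" "B \<noteq> {}"
  shows "vol_root A + vol_root B \<le> vol_root (A + B)"
proof -
  have "(vol_root A + vol_root B) ^ DIM('a) \<le> measure lebesgue (A + B) + e" if e: "0 < e" for e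
  proof -
    have "A + B \<in> lmeasurable" using A B by (simp add: lmeasurable_compact compact_set_plus)
    then obtain U where U: "open U" "A + B \<subseteq> U" "U \<in> lmeasurable"
        "measure lebesgue U < measure lebesgue (A + B) + e"
      using lmeasurable_outer_open e by blast
    obtain N where N: "open N" "bounded N" "0 \<in> N" "(A + N) + (B + N) \<subseteq> U"
      using exists_open_thickening[OF A(1) B(1) U(1,2)] .
    have thickening: "open (X + N)" "bounded (X + N)" "X + N \<noteq> {}" "vol_root X \<le> vol_root (X + N)"
      if X: "compact X" "X \<noteq> {}" for X
    proof -
      have "X \<subseteq> X + N" using N(3) by (force simp: set_plus_def)
      moreover show "open (X + N)" "bounded (X + N)"
        using X N by (simp_all add: open_set_plus bounded_set_plus compact_imp_bounded)
      ultimately show "X + N \<noteq> {}" "vol_root X \<le> vol_root (X + N)"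
        using X by (auto intro: vol_root_mono lmeasurable_open fmeasurableD[OF lmeasurable_compact])
    qed
    have "vol_root A + vol_root B \<le> vol_root (A + N) + vol_root (B + N)"
      by (intro add_mono thickening A B)
    also have "\<dots> \<le> vol_root ((A + N) + (B + N))"
      using Brunn_Minkowski_pair_open[of "A + N" "B + N"] thickening[OF A] thickening[OF B]
      by (simp add: Brunn_Minkowski_pair_def)
    also have "\<dots> \<le> vol_root U"
      using open_set_plus[of "A + N" "B + N"] thickening(1)[OF A] N(4) U(3)
      by (intro vol_root_mono) (auto intro: sets_completionI_sets borel_open)
    finally have "(vol_root A + vol_root B) ^ DIM('a) \<le> measure lebesgue U"
      by (simp add: le_vol_root_iff vol_root_nonneg)
    with U(4) show ?thesis by simp
  qed
  then have "(vol_root A + vol_root B) ^ DIM('a) \<le> measure lebesgue (A + B)"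
    by (rule field_le_epsilon)
  then show ?thesis by (simp add: le_vol_root_iff vol_root_nonneg)
qed

corollary vol_root_combination_le:
  fixes S T Z :: "'a::euclidean_space set"
  assumes S: "compact S" "S \<noteq> {}" and T: "compact T" "T \<noteq> {}" and uv: "0 \<le> u" "0 \<le> v"
    and Z: "Z \<in> lmeasurable" and subset: "\<And>x y. x \<in> S \<Longrightarrow> y \<in> T \<Longrightarrow> u *\<^sub>R x + v *\<^sub>R y \<in> Z"
  shows "u * vol_root S + v * vol_root T \<le> vol_root Z"
proof -
  let ?S = "(\<lambda>x. u *\<^sub>R x) ` S" and ?T = "(\<lambda>x. v *\<^sub>R x) ` T"
  have compact: "compact ?S" "compact ?T" using S T by (simp_all add: compact_scaling)
  have "u * vol_root S + v * vol_root T = vol_root ?S + vol_root ?T"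
    using uv by (simp add: vol_root_scaleR)
  also have "\<dots> \<le> vol_root (?S + ?T)"
    using S T compact by (intro Brunn_Minkowski_compact) auto
  also have "\<dots> \<le> vol_root Z"
    using compact subset Z
    by (intro vol_root_mono fmeasurableD[OF lmeasurable_compact] compact_set_plus) (auto simp: set_plus_def)
  finally show ?thesis .
qed

section \<open>Right derivatives at a maximum of a concave root\<close>

lemma convex_on_right_derivative_at_min:
  fixes f :: "real \<Rightarrow> real"
  assumes "a < b" and convex: "convex_on {a..b} f" and min: "\<And>t. t \<in> {a..b} \<Longrightarrow> f a \<le> f t"
  obtains D where "(f has_real_derivative D) (at_right a)" "0 \<le> D" "(b - a) * D \<le> f b - f a"
proof -
  define q where "q t = (f t - f a) / (t - a)" for t
  define D where "D = Inf (q ` ({a<..} \<inter> {a..b}))"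
  have mono: "q s \<le> q t" if "s \<in> {a..b}" "t \<in> {a..b}" "a < s" "s \<le> t" for s t
  proof (cases "s = t")
    case False
    have "q r = (f a - f r) / (a - r)" for r
      unfolding q_def by (metis minus_diff_eq minus_divide_divide)
    with False show ?thesis
      using convex_on_slope_le(1)[OF convex, of a t s] that by simp
  qed simp
  have nonneg: "0 \<le> q t" if "t \<in> {a..b}" "a < t" for t
    using min[OF that(1)] that by (simp add: q_def)
  have "(q \<longlongrightarrow> D) (at a within ({a<..} \<inter> {a..b}))"
    unfolding D_def using mono nonneg by (rule Lim_right_bound)
  moreover have "at a within ({a<..} \<inter> {a..b}) = at_right a"
    using \<open>a < b\<close> by (intro at_within_nhd[of a "{..<b}"]) auto
  ultimately have "(f has_real_derivative D) (at_right a)"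
    by (simp add: has_field_derivative_iff flip: q_def)
  moreover have "0 \<le> D"
    unfolding D_def using \<open>a < b\<close> nonneg by (intro cInf_greatest) auto
  moreover have "D \<le> q b"
    unfolding D_def using \<open>a < b\<close> nonneg by (intro cInf_lower bdd_belowI[of _ 0]) auto
  then have "(b - a) * D \<le> f b - f a"
    using \<open>a < b\<close> by (simp add: q_def field_simps)
  ultimately show thesis by (rule that)
qed

lemma has_real_derivative_of_root:
  assumes "0 < n" and nonneg: "\<And>t. t \<in> S \<Longrightarrow> 0 \<le> v t" and "x \<in> S"
    and root: "((\<lambda>t. root n (v t)) has_real_derivative D) (at x within S)"
  shows "(v has_real_derivative n * root n (v x) ^ (n - 1) * D) (at x within S)"
proof (rule has_field_derivative_transform_within[OF _ zero_less_one \<open>x \<in> S\<close>])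
  show "((\<lambda>t. root n (v t) ^ n) has_real_derivative n * root n (v x) ^ (n - 1) * D) (at x within S)"
    using DERIV_power[OF root, of n] by (simp add: mult_ac)
  show "root n (v t) ^ n = v t" if "t \<in> S" for t
    using nonneg[OF that] \<open>0 < n\<close> by simp
qed

lemma root_concave_right_derivative_at_max:
  fixes v :: "real \<Rightarrow> real"
  assumes "a < b" "0 < n" and nonneg: "\<And>t. t \<in> {a..b} \<Longrightarrow> 0 \<le> v t"
    and concave: "concave_on {a..b} (\<lambda>t. root n (v t))"
    and max: "\<And>t. t \<in> {a..b} \<Longrightarrow> v t \<le> v a" and ratio: "\<theta> * v a \<le> v b"
  obtains D where "(v has_real_derivative D) (at_right a)" "(b - a) * \<bar>D\<bar> \<le> n * (1 - root n \<theta>) * v a"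
proof -
  define g where "g t = root n (v t)" for t
  have g_a: "0 \<le> g a" "g a ^ n = v a"
    using nonneg[of a] \<open>a < b\<close> \<open>0 < n\<close> by (simp_all add: g_def)
  have "convex_on {a..b} (\<lambda>t. - g t)" "- g a \<le> - g t" if "t \<in> {a..b}" for t
    using concave max that \<open>0 < n\<close> by (simp_all add: concave_on_def g_def)
  then obtain E where E: "((\<lambda>t. - g t) has_real_derivative E) (at_right a)" "0 \<le> E"
      "(b - a) * E \<le> g a - g b"
    using convex_on_right_derivative_at_min[OF \<open>a < b\<close>, of "\<lambda>t. - g t"] \<open>a < b\<close> by force
  let ?c = "n * g a ^ (n - 1)"
  have "(g has_real_derivative - E) (at a within {a..b})"
    using DERIV_minus[OF E(1)] \<open>a < b\<close> by (simp add: at_within_Icc_at_right)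
  then have "(v has_real_derivative ?c * - E) (at a within {a..b})"
    unfolding g_def using \<open>0 < n\<close> \<open>a < b\<close> nonneg by (intro has_real_derivative_of_root) auto
  then have "(v has_real_derivative ?c * - E) (at_right a)"
    using \<open>a < b\<close> by (simp add: at_within_Icc_at_right)
  moreover have "(b - a) * \<bar>?c * - E\<bar> \<le> n * (1 - root n \<theta>) * v a"
  proof -
    have "root n \<theta> * g a \<le> g b"
      using ratio \<open>0 < n\<close> by (simp add: g_def flip: real_root_mult)
    then have "(b - a) * E \<le> (1 - root n \<theta>) * g a"
      using E(3) by (simp add: algebra_simps)
    then have "?c * ((b - a) * E) \<le> ?c * ((1 - root n \<theta>) * g a)"
      using g_a(1) by (intro mult_left_mono) auto
    also have "\<dots> = n * (1 - root n \<theta>) * (g a ^ (n - 1) * g a)"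
      by simp
    also have "g a ^ (n - 1) * g a = v a"
      unfolding g_a(2)[symmetric] using \<open>0 < n\<close> by (rule power_minus_mult)
    finally show ?thesis using E(2) g_a(1) by (simp add: abs_mult mult_ac)
  qed
  ultimately show thesis by (rule that)
qed

lemma convex_ray_mem:
  assumes "convex S" "p \<in> S" "p + r *\<^sub>R e \<in> S" "t \<in> {0..r}"
  shows "p + t *\<^sub>R e \<in> S"
proof (cases "r = 0")
  case False
  then have "(1 - t / r) *\<^sub>R p + (t / r) *\<^sub>R (p + r *\<^sub>R e) \<in> S"
    using assms by (intro convexD_alt) auto
  with False show ?thesis by (simp add: algebra_simps)
qed (use assms in auto)

lemma concave_on_ray:
  assumes concave: "concave_on S f" and "p \<in> S" "p + r *\<^sub>R e \<in> S"
  shows "concave_on {0..r} (\<lambda>t. f (p + t *\<^sub>R e))"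
  unfolding concave_on_iff
proof (intro conjI ballI allI impI)
  fix s t u v :: real
  assume st: "s \<in> {0..r}" "t \<in> {0..r}" and uv: "0 \<le> u" "0 \<le> v" "u + v = 1"
  have "convex S" using concave by (simp add: concave_on_iff)
  then have "p + s *\<^sub>R e \<in> S" "p + t *\<^sub>R e \<in> S"
    using assms st by (blast intro: convex_ray_mem)+
  then have "u * f (p + s *\<^sub>R e) + v * f (p + t *\<^sub>R e) \<le> f (u *\<^sub>R (p + s *\<^sub>R e) + v *\<^sub>R (p + t *\<^sub>R e))"
    using concave uv by (simp add: concave_on_iff)
  also have "u *\<^sub>R (p + s *\<^sub>R e) + v *\<^sub>R (p + t *\<^sub>R e) = (u + v) *\<^sub>R p + (u *\<^sub>R s + v *\<^sub>R t) *\<^sub>R e"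
    by (simp add: algebra_simps)
  finally show "u * f (p + s *\<^sub>R e) + v * f (p + t *\<^sub>R e) \<le> f (p + (u *\<^sub>R s + v *\<^sub>R t) *\<^sub>R e)"
    by (simp only: uv scaleR_one)
qed simp

section \<open>Slices and their volumes\<close>

definition conv_slice :: "'a::ab_group_add set \<Rightarrow> 'a set \<Rightarrow> 'a \<Rightarrow> 'a set" where
  "conv_slice K L x = K \<inter> (\<lambda>y. x - y) ` L"

lemma mem_conv_slice: "p \<in> conv_slice K L x \<longleftrightarrow> p \<in> K \<and> x - p \<in> L"
  by (force simp: conv_slice_def)

lemma conv_slice_nonempty_iff: "conv_slice K L x \<noteq> {} \<longleftrightarrow> x \<in> K + L"
  by (force simp: mem_conv_slice set_plus_def)

lemma compact_conv_slice:
  fixes K L :: "'a::real_normed_vector set"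
  assumes "compact K" "compact L"
  shows "compact (conv_slice K L x)"
  unfolding conv_slice_def using assms
  by (intro compact_Int compact_continuous_image continuous_intros)

lemma concave_on_vol_root_conv_slice:
  fixes K L :: "'a::euclidean_space set"
  assumes K: "compact K" "convex K" and L: "compact L" "convex L"
  shows "concave_on (K + L) (\<lambda>x. vol_root (conv_slice K L x))"
  unfolding concave_on_iff
proof (intro conjI ballI allI impI)
  show "convex (K + L)" using K L by (simp add: convex_set_plus)
  fix x y and u v :: real
  assume xy: "x \<in> K + L" "y \<in> K + L" and uv: "0 \<le> u" "0 \<le> v" "u + v = 1"
  have "u *\<^sub>R p + v *\<^sub>R q \<in> conv_slice K L (u *\<^sub>R x + v *\<^sub>R y)"
    if "p \<in> conv_slice K L x" "q \<in> conv_slice K L y" for p q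
  proof -
    have "u *\<^sub>R p + v *\<^sub>R q \<in> K" "u *\<^sub>R (x - p) + v *\<^sub>R (y - q) \<in> L"
      using that uv K L by (auto simp: mem_conv_slice intro: convexD)
    then show ?thesis by (simp add: mem_conv_slice algebra_simps)
  qed
  then show "u * vol_root (conv_slice K L x) + v * vol_root (conv_slice K L y)
      \<le> vol_root (conv_slice K L (u *\<^sub>R x + v *\<^sub>R y))"
    using K L xy uv
    by (intro vol_root_combination_le compact_conv_slice lmeasurable_compact)
       (auto simp: conv_slice_nonempty_iff)
qed

lemma conv_vol_eq_measure_conv_slice: "conv_vol K L x = measure lebesgue (conv_slice K L x)"
  by (simp add: conv_vol_def conv_slice_def)

lemma root_conv_vol: "root CARD('n) (conv_vol K L x) = vol_root (conv_slice K L x)" for x :: "real ^ 'n"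
  by (simp add: conv_vol_eq_measure_conv_slice vol_root_def)

lemma conv_vol_le_max_conv_vol:
  assumes "compact K" "compact L" "x \<in> K + L"
  shows "conv_vol K L x \<le> max_conv_vol K L"
  unfolding max_conv_vol_def
proof (rule cSUP_upper[OF assms(3)])
  have "conv_vol K L y \<le> measure lebesgue K" for y
    unfolding conv_vol_eq_measure_conv_slice using assms
    by (intro measure_mono_fmeasurable fmeasurableD lmeasurable_compact compact_conv_slice)
       (auto simp: mem_conv_slice)
  then show "bdd_above (conv_vol K L ` (K + L))" by (intro bdd_aboveI[of _ "measure lebesgue K"]) blast
qed

lemma max_conv_vol_pos:
  assumes K: "compact K" "interior K \<noteq> {}" and L: "compact L" "interior L \<noteq> {}"
  shows "0 < max_conv_vol K L"
proof -
  obtain p q where pq: "p \<in> interior K" "q \<in> interior L"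
    using K L by blast
  let ?U = "conv_slice (interior K) (interior L) (p + q)"
  have "(\<lambda>y. (p + q) - y) ` interior L = (\<lambda>y. (p + q) + y) ` (\<lambda>y. - y) ` interior L"
    by (simp add: image_image)
  then have "open ?U"
    unfolding conv_slice_def by (simp add: open_Int open_translation open_negations)
  moreover have "bounded ?U"
    unfolding conv_slice_def using K by (intro bounded_Int disjI1 bounded_interior compact_imp_bounded)
  moreover have "p \<in> ?U" using pq by (simp add: mem_conv_slice)
  ultimately have "0 < measure lebesgue ?U" "?U \<in> sets lebesgue"
    using measure_open_pos lmeasurable_open by (blast intro: fmeasurableD)+
  moreover have "?U \<subseteq> conv_slice K L (p + q)"
    using interior_subset by (force simp: mem_conv_slice)
  ultimately have "0 < conv_vol K L (p + q)"
    unfolding conv_vol_eq_measure_conv_slice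
    using K L by (meson compact_conv_slice lmeasurable_compact measure_mono_fmeasurable order_less_le_trans)
  also have "\<dots> \<le> max_conv_vol K L"
    using K L pq interior_subset by (intro conv_vol_le_max_conv_vol) blast+
  finally show ?thesis .
qed

lemma conv_vol_right_derivative_at_max:
  fixes K L :: "(real ^ 'n) set"
  assumes K: "compact K" "convex K" and L: "compact L" "convex L"
    and p: "p \<in> K + L" "p + r *\<^sub>R e \<in> K + L" and "0 < r"
    and max: "\<And>y. y \<in> K + L \<Longrightarrow> conv_vol K L y \<le> conv_vol K L p"
    and ratio: "\<theta> * conv_vol K L p \<le> conv_vol K L (p + r *\<^sub>R e)"
  obtains D where "((\<lambda>t. conv_vol K L (p + t *\<^sub>R e)) has_real_derivative D) (at_right 0)"
    "r * \<bar>D\<bar> \<le> CARD('n) * (1 - root CARD('n) \<theta>) * conv_vol K L p"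
proof -
  define v where "v t = conv_vol K L (p + t *\<^sub>R e)" for t
  have "concave_on {0..r} (\<lambda>t. root CARD('n) (v t))"
    unfolding v_def root_conv_vol
    using concave_on_ray[OF concave_on_vol_root_conv_slice[OF K L] p] .
  moreover have "v t \<le> v 0" if "t \<in> {0..r}" for t
    using max convex_ray_mem[OF convex_set_plus[OF K(2) L(2)] p that] by (simp add: v_def)
  moreover have "0 \<le> v t" for t
    by (simp add: v_def conv_vol_def)
  moreover have "\<theta> * v 0 \<le> v r"
    using ratio by (simp add: v_def)
  ultimately obtain D where "(v has_real_derivative D) (at_right 0)"
      "(r - 0) * \<bar>D\<bar> \<le> CARD('n) * (1 - root CARD('n) \<theta>) * v 0"
    using root_concave_right_derivative_at_max[of 0 r "CARD('n)" v \<theta>] \<open>0 < r\<close> by (metis zero_less_card_finite)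
  then show thesis using that by (simp add: v_def[abs_def])
qed

theorem proposition4p1:
  fixes K L :: "(real ^ 'n) set" and \<theta> :: real
  assumes "convex_body K" and "convex_body L"
    and "max_conv_vol K L = measure lebesgue (K \<inter> uminus ` L)"
    and "0 < \<theta>" and "\<theta> < 1"
  shows "theta_sum \<theta> K L \<subseteq>
    {x. x = 0 \<or>
        (\<exists>D. ((\<lambda>t. conv_vol K L (t *\<^sub>R (x /\<^sub>R norm x))) has_real_derivative D) (at_right 0) \<and>
             norm x * \<bar>D\<bar> \<le> real CARD('n) * (1 - \<theta> powr (1 / real CARD('n))) * max_conv_vol K L)}"
proof (intro subsetI CollectI disj_imp[THEN iffD2] impI)
  fix x assume x: "x \<in> theta_sum \<theta> K L" "x \<noteq> 0"
  have K: "compact K" "convex K" "interior K \<noteq> {}" and L: "compact L" "convex L" "interior L \<noteq> {}"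
    using assms by (simp_all add: convex_body_def)
  have max_at_0: "conv_vol K L 0 = max_conv_vol K L"
    using assms(3) by (simp add: conv_vol_def)
  then have "0 < conv_vol K L 0"
    using max_conv_vol_pos[OF K(1,3) L(1,3)] by simp
  then have zero_mem: "0 \<in> K + L"
    by (auto simp: conv_vol_eq_measure_conv_slice simp flip: conv_slice_nonempty_iff)
  have "0 + norm x *\<^sub>R (x /\<^sub>R norm x) = x"
    using x(2) by simp
  with x obtain D where "((\<lambda>t. conv_vol K L (0 + t *\<^sub>R (x /\<^sub>R norm x))) has_real_derivative D) (at_right 0)"
      "norm x * \<bar>D\<bar> \<le> CARD('n) * (1 - root CARD('n) \<theta>) * conv_vol K L 0"
    using conv_vol_right_derivative_at_max[OF K(1,2) L(1,2) zero_mem, of "norm x" "x /\<^sub>R norm x" \<theta>]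
      conv_vol_le_max_conv_vol[OF K(1) L(1)]
    unfolding theta_sum_def max_at_0 by auto
  then show "\<exists>D. ((\<lambda>t. conv_vol K L (t *\<^sub>R (x /\<^sub>R norm x))) has_real_derivative D) (at_right 0) \<and>
      norm x * \<bar>D\<bar> \<le> real CARD('n) * (1 - \<theta> powr (1 / real CARD('n))) * max_conv_vol K L"
    using assms(4) by (auto simp: max_at_0 root_powr_inverse)
qed

end
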